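(* Let $d \ge 2$, $n \in \{2,4,8\}$, let $n_1 \le \dots \le n_d$ be positive integers, and let $\mathbf{X} \in \mathbb{R}^{n_1 \times \dots \times n_d}$ be orthogonal. Fix any $\mu \in \{1,\dots,d-1\}$ satisfying $n \le n_\mu$, and take any $n$ (distinct) slices $\mathbf{X}_1,\dots,\mathbf{X}_n$ of $\mathbf{X}$ perpendicular to mode $\mu$. Let $\mathbf{Y}$ be the real tensor of order $d+1$ and size $n_1 \times \dots \times n_{\mu-1} \times n\times n \times n_{\mu+1} \times \dots \times n_d$ obtained from the table $T_n$ (given in the context) by using $\mathbf{X}_k$ instead of $e_k$; that is, for all $i,j\in\{1,\dots,n\}$, \[ \mathbf{Y}(:,\dots,:,i,j,:,\dots,:)=\pm\mathbf{X}_k \quad\text{whenever the $(i,j)$ entry of $T_n$ is } \pm e_k , \] where $i,j$ are the indices in modes $\mu$ and $\mu+1$. Then $\mathbf{Y}$ is orthogonal.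
   Context: Orthogonal tensors: a vector is orthogonal if its Euclidean norm is one; for $m_1\le\dots\le m_D$, $D\ge2$, a real tensor $\mathbf{X}\in\mathbb{R}^{m_1\times\dots\times m_D}$ is orthogonal if for every unit vector $u\in\mathbb{R}^{m_1}$ the order-$(D-1)$ tensor $\mathbf{X}\times_1u$ with entries $\sum_{i}u(i)\mathbf{X}(i,i_2,\dots,i_D)$ is orthogonal. If the dimensions are not in nondecreasing order, a tensor is called orthogonal if the tensor obtained by permuting its modes so that the dimensions become nondecreasing is orthogonal (this does not depend on the choice of such a permutation). A slice of $\mathbf{X}$ perpendicular to mode $\mu$ is a tensor $\mathbf{X}(:,\dots,:,i_\mu,:,\dots,:)\in\mathbb{R}^{n_1\times\dots\times n_{\mu-1}\times n_{\mu+1}\times\dots\times n_d}$ obtained by fixing the index $i_\mu$. The tables are the multiplication tables of the complex numbers, quaternions and octonions (here $e_k$ denotes the $k$-th standard unit vector of $\mathbb{R}^n$): \[ T_2=\begin{bmatrix} e_1 & e_2 \\ e_2 & -e_1\end{bmatrix},\qquad T_4=\begin{bmatrix} e_1 & e_2 & e_3 & e_4 \\ e_2 & -e_1 & e_4 & -e_3 \\ e_3 & -e_4 & -e_1 & e_2 \\ e_4 & e_3 & -e_2 & -e_1 \end{bmatrix}, \] \[ T_8=\begin{bmatrix} e_1 & e_2 & e_3 & e_4 & e_5 & e_6 & e_7 & e_8 \\ e_2 & -e_1 & e_4 & -e_3 & e_6 & -e_5 & -e_8 & e_7 \\ e_3 & -e_4 & -e_1 & e_2 & e_7 & e_8 &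 -e_5 & -e_6 \\ e_4 & e_3 & -e_2 & -e_1 & e_8 & -e_7 & e_6 & -e_5 \\ e_5 & -e_6 & -e_7 & -e_8 & -e_1 & e_2 & e_3 & e_4 \\ e_6 & e_5 & -e_8 & e_7 & -e_2 & -e_1 & -e_4 & e_3 \\ e_7 & e_8 & e_5 & -e_6 & -e_3 & e_4 & -e_1 & -e_2 \\ e_8 & -e_7 & e_6 & e_5 & -e_4 & -e_3 & e_2 & -e_1 \end{bmatrix}. \] *)

theory Defs
  imports "HOL-Analysis.L2_Norm" "HOL-Combinatorics.Permutations"
begin

text \<open>
  A real tensor of size \<open>n\<^sub>1 \<times> \<dots> \<times> n\<^sub>d\<close> is given by the list \<open>ns = [n\<^sub>1, \<dots>, n\<^sub>d]\<close> of its
  dimensions and its entry function on index lists. Modes and indices are counted from 0; only the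
  values at valid index lists are meaningful.
\<close>

type_synonym tensor = "nat list \<Rightarrow> real"

definition valid_index :: "nat list \<Rightarrow> nat list \<Rightarrow> bool" where
  "valid_index ns is \<longleftrightarrow> length is = length ns \<and> (\<forall>k < length ns. is ! k < ns ! k)"

definition tensor_eq :: "nat list \<Rightarrow> tensor \<Rightarrow> tensor \<Rightarrow> bool" where
  "tensor_eq ns X Y \<longleftrightarrow> (\<forall>is. valid_index ns is \<longrightarrow> X is = Y is)"

definition slice :: "nat \<Rightarrow> nat \<Rightarrow> tensor \<Rightarrow> tensor" where
  "slice \<mu> i X = (\<lambda>is. X (take \<mu> is @ i # drop \<mu> is))"

text \<open>The product of a tensor of first dimension \<open>m\<close> with a vector \<open>u\<close> of length \<open>m\<close> along the
  first mode.\<close>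

definition first_mode_product :: "nat \<Rightarrow> tensor \<Rightarrow> (nat \<Rightarrow> real) \<Rightarrow> tensor" where
  "first_mode_product m X u = (\<lambda>is. \<Sum>i<m. u i * X (i # is))"

text \<open>Orthogonality for nondecreasing dimensions. Order 0 is not a case of the notion; its value
  is a dummy.\<close>

fun sorted_orthogonal :: "nat list \<Rightarrow> tensor \<Rightarrow> bool" where
  "sorted_orthogonal [] X \<longleftrightarrow> False"
| "sorted_orthogonal [m] X \<longleftrightarrow> L2_set (\<lambda>i. X [i]) {..<m} = 1"
| "sorted_orthogonal (m # m' # ms) X \<longleftrightarrow>
     (\<forall>u. L2_set u {..<m} = 1 \<longrightarrow> sorted_orthogonal (m' # ms) (first_mode_product m X u))"

text \<open>Mode \<open>k\<close> of the permuted tensor is mode \<open>p k\<close> of \<open>X\<close>: its entry at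
  \<open>permute_list p is\<close> is \<open>X is\<close>.\<close>

definition permute_modes :: "(nat \<Rightarrow> nat) \<Rightarrow> tensor \<Rightarrow> tensor" where
  "permute_modes p X = (\<lambda>is. X (permute_list (inv p) is))"

text \<open>Orthogonality of the permuted tensor does not depend on the sorting permutation, so an
  existential quantifier expresses the choice of one.\<close>

definition orthogonal_tensor :: "nat list \<Rightarrow> tensor \<Rightarrow> bool" where
  "orthogonal_tensor ns X \<longleftrightarrow>
     (if sorted ns then sorted_orthogonal ns X
      else \<exists>p. p permutes {..<length ns} \<and> sorted (permute_list p ns) \<and>
               sorted_orthogonal (permute_list p ns) (permute_modes p X))"

text \<open>The multiplication tables of the complex numbers, quaternions and octonions. The entries
  \<open>k\<close> and \<open>- k\<close> stand for the unit vectors \<open>e\<^sub>k\<close> and \<open>- e\<^sub>k\<close>, where here \<open>k\<close> counts from 1.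
  For \<open>n \<notin> {2, 4, 8}\<close> the table is a dummy.\<close>

definition mult_table :: "nat \<Rightarrow> int list list" where
  "mult_table n =
    (if n = 2 then
       [[1, 2],
        [2, -1]]
     else if n = 4 then
       [[1, 2, 3, 4],
        [2, -1, 4, -3],
        [3, -4, -1, 2],
        [4, 3, -2, -1]]
     else if n = 8 then
       [[1, 2, 3, 4, 5, 6, 7, 8],
        [2, -1, 4, -3, 6, -5, -8, 7],
        [3, -4, -1, 2, 7, 8, -5, -6],
        [4, 3, -2, -1, 8, -7, 6, -5],
        [5, -6, -7, -8, -1, 2, 3, 4],
        [6, 5, -8, 7, -2, -1, -4, 3],
        [7, 8, 5, -6, -3, 4, -1, -2],
        [8, -7, 6, 5, -4, -3, 2, -1]]
     else [])"

end

theory Submission imports Defs begin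

text \<open>
  Orthogonality of a tensor whose last dimension is maximal is a statement about norms: the
  contraction of the tensor with vectors \<open>u\<^sub>0, \<dots>, u\<^sub>r\<close> in all modes but the last is a vector whose
  norm is the product of the norms of the \<open>u\<^sub>k\<close>
  (\<open>sorted_orthogonal_iff_norm_multiplicative\<close>). For unit vectors this is the definition unfolded,
  and homogeneity extends it to all vectors. In this form the order of the contracted modes is
  irrelevant, so an unsorted list of dimensions needs no real work as long as its last entry is
  maximal (\<open>orthogonal_tensorI\<close>).

  Let \<open>\<cdot>\<close> be the product that the table puts on \<open>\<real>\<^sup>n\<close>. Contracting the two table modes of \<open>Y\<close>
  with \<open>v\<close> and \<open>w\<close> gives the combination of the chosen slices \<open>X\<^sub>k\<close> with coefficients \<open>(v \<cdot> w)\<^sub>k\<close>.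
  This is the contraction of mode \<open>\<mu>\<close> of \<open>X\<close> with the vector that carries \<open>(v \<cdot> w)\<^sub>k\<close> at the position
  of the slice \<open>X\<^sub>k\<close> and zeros elsewhere (\<open>contract_table_tensor\<close>). As the slices are distinct,
  the norm of that vector is the norm of \<open>v \<cdot> w\<close>, which is the product of the norms of \<open>v\<close> and \<open>w\<close>,
  because the norm is multiplicative on the complex numbers, quaternions and octonions
  (\<open>table_product_norm\<close>). Hence the norm condition passes from \<open>X\<close> to \<open>Y\<close>. Mode \<open>\<mu>\<close> is not the
  last one, so the maximal last dimension is the same for both tensors.
\<close>

section \<open>Contraction of a tensor with vectors\<close>

definition indices :: "nat list \<Rightarrow> nat list set" where
  "indices ms = {is. valid_index ms is}"

definition contract :: "nat list \<Rightarrow> tensor \<Rightarrow> (nat \<Rightarrow> nat \<Rightarrow> real) \<Rightarrow> real" where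
  "contract ms X U = (\<Sum>is\<in>indices ms. (\<Prod>k<length ms. U k (is ! k)) * X is)"

lemma indices_Nil [simp]: "indices [] = {[]}"
  by (auto simp: indices_def valid_index_def)

lemma indices_Cons: "indices (m # ms) = (\<lambda>(i, is). i # is) ` ({..<m} \<times> indices ms)"
proof (intro equalityI subsetI)
  fix js assume js: "js \<in> indices (m # ms)"
  then obtain i "is" where "js = i # is" "length is = length ms"
    by (auto simp: indices_def valid_index_def length_Suc_conv)
  with js show "js \<in> (\<lambda>(i, is). i # is) ` ({..<m} \<times> indices ms)"
    by (force simp: indices_def valid_index_def)
qed (auto simp: indices_def valid_index_def less_Suc_eq_0_disj)

lemma contract_Nil [simp]: "contract [] X U = X []"
  by (simp add: contract_def)

lemma contract_Cons:
  "contract (m # ms) X U = (\<Sum>i<m. U 0 i * contract ms (\<lambda>is. X (i # is)) (\<lambda>k. U (Suc k)))"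
proof -
  have "inj_on (\<lambda>(i, is). i # is) ({..<m} \<times> indices ms)"
    by (auto simp: inj_on_def)
  then have "contract (m # ms) X U =
      (\<Sum>(i, is)\<in>{..<m} \<times> indices ms. U 0 i * ((\<Prod>k<length ms. U (Suc k) (is ! k)) * X (i # is)))"
    unfolding contract_def indices_Cons
    by (simp add: sum.reindex prod.lessThan_Suc_shift case_prod_unfold mult.assoc
        del: prod.lessThan_Suc)
  then show ?thesis
    by (simp add: contract_def sum.cartesian_product sum_distrib_left)
qed

lemma contract_cong:
  "(\<And>is. valid_index ms is \<Longrightarrow> X is = Y is) \<Longrightarrow> contract ms X U = contract ms Y U"
  by (simp add: contract_def indices_def)

lemma contract_cmult: "contract ms (\<lambda>is. c * X is) U = c * contract ms X U"
  by (simp add: contract_def sum_distrib_left mult.left_commute)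

lemma contract_sum:
  "contract ms (\<lambda>is. \<Sum>i\<in>A. X i is) U = (\<Sum>i\<in>A. contract ms (X i) U)"
  unfolding contract_def by (subst sum.swap) (simp add: sum_distrib_left)

text \<open>Expansion along a single mode, with the slices contracted in their own modes. Mode \<open>\<mu>\<close> of the larger tensor is the one
  inserted, so the vectors of the later modes move by one place.\<close>

lemma contract_insert_mode:
  assumes "\<mu> \<le> length ms"
  shows "contract (take \<mu> ms @ m # drop \<mu> ms) X U =
    (\<Sum>i<m. U \<mu> i * contract ms (slice \<mu> i X) (\<lambda>k. U (if k < \<mu> then k else Suc k)))"
  using assms
proof (induction \<mu> arbitrary: ms X U)
  case 0
  then show ?case by (simp add: contract_Cons slice_def)
next
  case (Suc \<mu>)
  then obtain l ls where ms: "ms = l # ls" and le: "\<mu> \<le> length ls"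
    by (cases ms) auto
  have "contract (take (Suc \<mu>) ms @ m # drop (Suc \<mu>) ms) X U =
    (\<Sum>h<l. U 0 h * (\<Sum>i<m. U (Suc \<mu>) i *
       contract ls (slice \<mu> i (\<lambda>is. X (h # is))) (\<lambda>k. U (Suc (if k < \<mu> then k else Suc k)))))"
    by (simp add: ms contract_Cons Suc.IH[OF le])
  also have "\<dots> = (\<Sum>i<m. \<Sum>h<l. U (Suc \<mu>) i * (U 0 h *
       contract ls (slice \<mu> i (\<lambda>is. X (h # is))) (\<lambda>k. U (Suc (if k < \<mu> then k else Suc k)))))"
    by (subst sum.swap) (simp add: sum_distrib_left mult.left_commute)
  also have "\<dots> = (\<Sum>i<m. U (Suc \<mu>) i *
      contract ms (slice (Suc \<mu>) i X) (\<lambda>k. U (if k < Suc \<mu> then k else Suc k)))"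
    by (simp add: ms contract_Cons slice_def sum_distrib_left if_distrib)
  finally show ?case .
qed

section \<open>Orthogonality as multiplicativity of norms\<close>

lemma valid_index_permute_list:
  assumes "p permutes {..<length ms}" "valid_index ms is"
  shows "valid_index (permute_list p ms) (permute_list p is)"
  using assms permutes_in_image[OF assms(1)]
  by (auto simp: valid_index_def permute_list_nth)

lemma permute_list_inv_cancel:
  assumes "p permutes {..<length xs}"
  shows "permute_list p (permute_list (inv p) xs) = xs"
    and "permute_list (inv p) (permute_list p xs) = xs"
  using assms permutes_inv[OF assms]
  by (simp_all flip: permute_list_compose add: permutes_inv_o)

lemma contract_permute_modes:
  assumes p: "p permutes {..<length ms}"
  shows "contract (permute_list p ms) (permute_modes p X) U = contract ms X (\<lambda>k. U (inv p k))"
proof -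
  have "contract ms X (\<lambda>k. U (inv p k)) =
      (\<Sum>is\<in>indices ms. (\<Prod>k<length ms. U k (permute_list p is ! k)) * X is)"
    unfolding contract_def
  proof (intro sum.cong refl arg_cong2[where f = "(*)"])
    fix "is" assume "is \<in> indices ms"
    then have len: "length is = length ms" by (simp add: indices_def valid_index_def)
    have "(\<Prod>k<length ms. U (inv p k) (is ! k)) =
        (\<Prod>k<length ms. U (inv p (p k)) (is ! p k))"
      using p by (subst prod.permute[OF p]) (simp add: comp_def)
    also have "\<dots> = (\<Prod>k<length ms. U k (permute_list p is ! k))"
      using p by (simp add: permutes_inverses permute_list_nth len)
    finally show "(\<Prod>k<length ms. U (inv p k) (is ! k)) = (\<Prod>k<length ms. U k (permute_list p is ! k))" .
  qed
  also have "\<dots> = contract (permute_list p ms) (permute_modes p X) U"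
    unfolding contract_def
  proof (rule sum.reindex_bij_witness[where i = "permute_list (inv p)" and j = "permute_list p"])
    fix "is" assume "is \<in> indices ms"
    then have v: "valid_index ms is" by (simp add: indices_def)
    then have p': "p permutes {..<length is}" using p by (simp add: valid_index_def)
    show c: "permute_list (inv p) (permute_list p is) = is"
      by (rule permute_list_inv_cancel[OF p'])
    show "permute_list p is \<in> indices (permute_list p ms)"
      using valid_index_permute_list[OF p v] by (simp add: indices_def)
    show "(\<Prod>k<length (permute_list p ms). U k (permute_list p is ! k)) *
        permute_modes p X (permute_list p is) =
        (\<Prod>k<length ms. U k (permute_list p is ! k)) * X is"
      by (simp add: permute_modes_def c)
  next
    fix js assume "js \<in> indices (permute_list p ms)"
    then have v: "valid_index (permute_list p ms) js" by (simp add: indices_def)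
    then have p': "p permutes {..<length js}" using p by (simp add: valid_index_def)
    show "permute_list p (permute_list (inv p) js) = js"
      by (rule permute_list_inv_cancel[OF p'])
    show "permute_list (inv p) js \<in> indices ms"
      using valid_index_permute_list[of "inv p", OF _ v] permutes_inv[OF p]
      by (simp add: indices_def permute_list_inv_cancel[OF p])
  qed
  finally show ?thesis ..
qed

text \<open>The tensor has dimensions \<open>ms @ [m]\<close>. The last mode stays open, and the vectors \<open>U k\<close> are
  arbitrary rather than of norm one, so that the condition can be applied to vectors such as
  table products without normalizing them.\<close>

definition norm_multiplicative :: "nat list \<Rightarrow> nat \<Rightarrow> tensor \<Rightarrow> bool" where
  "norm_multiplicative ms m X \<longleftrightarrow>
     (\<forall>U. L2_set (\<lambda>j. contract ms (\<lambda>is. X (is @ [j])) U) {..<m} =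
          (\<Prod>k<length ms. L2_set (U k) {..<ms ! k}))"

lemma contract_first_mode_product:
  "contract ms (\<lambda>is. first_mode_product l X u (is @ [j])) U =
   contract (l # ms) (\<lambda>is. X (is @ [j])) (case_nat u U)"
  by (simp add: first_mode_product_def contract_sum contract_cmult contract_Cons)

text \<open>Both sides of the norm equation are homogeneous in the vector of the first mode, so unit
  vectors suffice there.\<close>

lemma norm_multiplicative_Cons:
  "norm_multiplicative (l # ms) m X \<longleftrightarrow>
     (\<forall>u. L2_set u {..<l} = 1 \<longrightarrow> norm_multiplicative ms m (first_mode_product l X u))"
proof (intro iffI allI impI)
  fix u :: "nat \<Rightarrow> real"
  assume "norm_multiplicative (l # ms) m X" and "L2_set u {..<l} = 1"
  then show "norm_multiplicative ms m (first_mode_product l X u)"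
    unfolding norm_multiplicative_def contract_first_mode_product
    by (auto simp: prod.lessThan_Suc_shift simp del: prod.lessThan_Suc)
next
  assume unit: "\<forall>u. L2_set u {..<l} = 1 \<longrightarrow> norm_multiplicative ms m (first_mode_product l X u)"
  show "norm_multiplicative (l # ms) m X"
    unfolding norm_multiplicative_def
  proof
    fix U :: "nat \<Rightarrow> nat \<Rightarrow> real"
    define c where "c = L2_set (U 0) {..<l}"
    define V where "V = (\<lambda>k. U (Suc k))"
    have c0: "c \<ge> 0" by (simp add: c_def)
    have "L2_set (\<lambda>j. contract (l # ms) (\<lambda>is. X (is @ [j])) U) {..<m} =
        c * (\<Prod>k<length ms. L2_set (V k) {..<ms ! k})"
    proof (cases "c = 0")
      case True
      then have "\<forall>i<l. U 0 i = 0" by (auto simp: c_def L2_set_eq_0_iff)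
      then have "contract (l # ms) (\<lambda>is. X (is @ [j])) U = 0" for j by (simp add: contract_Cons)
      then show ?thesis by (simp add: True L2_set_def)
    next
      case False
      define u where "u = (\<lambda>i. U 0 i / c)"
      have "L2_set u {..<l} = L2_set (\<lambda>i. (1 / c) * U 0 i) {..<l}" by (simp add: u_def)
      also have "\<dots> = (1 / c) * c"
        using c0 by (subst L2_set_right_distrib[symmetric]) (simp_all add: c_def)
      finally have "L2_set u {..<l} = 1" using False by simp
      with unit have "L2_set (\<lambda>j. contract (l # ms) (\<lambda>is. X (is @ [j])) (case_nat u V)) {..<m} =
          (\<Prod>k<length ms. L2_set (V k) {..<ms ! k})"
        by (simp add: norm_multiplicative_def contract_first_mode_product)
      moreover have "contract (l # ms) (\<lambda>is. X (is @ [j])) U =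
          c * contract (l # ms) (\<lambda>is. X (is @ [j])) (case_nat u V)" for j
        using False by (simp add: contract_Cons u_def V_def sum_distrib_left flip: mult.assoc)
      ultimately show ?thesis by (simp flip: L2_set_right_distrib[OF c0])
    qed
    then show "L2_set (\<lambda>j. contract (l # ms) (\<lambda>is. X (is @ [j])) U) {..<m} =
        (\<Prod>k<length (l # ms). L2_set (U k) {..<(l # ms) ! k})"
      by (simp add: c_def V_def prod.lessThan_Suc_shift del: prod.lessThan_Suc)
  qed
qed

lemma sorted_orthogonal_iff_norm_multiplicative:
  "sorted_orthogonal (ms @ [m]) X \<longleftrightarrow> norm_multiplicative ms m X"
proof (induction ms arbitrary: X)
  case Nil
  show ?case by (simp add: norm_multiplicative_def)
next
  case (Cons l ms)
  obtain l' ls where "ms @ [m] = l' # ls" by (cases "ms @ [m]") auto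
  then have "sorted_orthogonal ((l # ms) @ [m]) X \<longleftrightarrow>
      (\<forall>u. L2_set u {..<l} = 1 \<longrightarrow> sorted_orthogonal (ms @ [m]) (first_mode_product l X u))"
    by simp
  then show ?case by (simp add: Cons.IH norm_multiplicative_Cons)
qed

lemma permute_list_snoc:
  assumes "p permutes {..<length xs}"
  shows "permute_list p (xs @ [x]) = permute_list p xs @ [x]"
proof -
  have "p (length xs) = length xs" using assms by (simp add: permutes_def)
  moreover have "p i < length xs" if "i < length xs" for i
    using permutes_in_image[OF assms, of i] that by simp
  ultimately show ?thesis by (simp add: permute_list_def nth_append)
qed

text \<open>A permutation that fixes the last mode only reorders the factors of the product of norms.\<close>

lemma norm_multiplicative_permute_modes:
  assumes p: "p permutes {..<length ms}" and X: "norm_multiplicative ms m X"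
  shows "norm_multiplicative (permute_list p ms) m (permute_modes p X)"
  unfolding norm_multiplicative_def
proof
  fix U :: "nat \<Rightarrow> nat \<Rightarrow> real"
  note p' = permutes_inv[OF p]
  have "contract (permute_list p ms) (\<lambda>is. permute_modes p X (is @ [j])) U =
      contract ms (\<lambda>is. X (is @ [j])) (\<lambda>k. U (inv p k))" for j
  proof -
    have "contract (permute_list p ms) (\<lambda>is. permute_modes p X (is @ [j])) U =
        contract (permute_list p ms) (permute_modes p (\<lambda>is. X (is @ [j]))) U"
      by (rule contract_cong)
        (use p' in \<open>simp add: permute_modes_def valid_index_def permute_list_snoc\<close>)
    then show ?thesis by (simp add: contract_permute_modes[OF p])
  qed
  then have "L2_set (\<lambda>j. contract (permute_list p ms) (\<lambda>is. permute_modes p X (is @ [j])) U) {..<m} =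
      (\<Prod>k<length ms. L2_set (U (inv p k)) {..<ms ! k})"
    using X by (simp add: norm_multiplicative_def)
  also have "\<dots> = (\<Prod>k<length ms. L2_set (U k) {..<permute_list p ms ! k})"
    using p by (subst prod.permute[OF p]) (simp add: comp_def permutes_inverses permute_list_nth)
  finally show "L2_set (\<lambda>j. contract (permute_list p ms) (\<lambda>is. permute_modes p X (is @ [j])) U) {..<m} =
      (\<Prod>k<length (permute_list p ms). L2_set (U k) {..<permute_list p ms ! k})" by simp
qed

text \<open>Since the last dimension is maximal, a permutation that sorts the other modes and fixes the
  last one sorts all of them. The order of \<open>ms\<close> itself is arbitrary, which is what covers
  dimensions such as \<open>4, 2, 2, 5\<close>, where a pair of equal
  dimensions has been put in place of a larger one.\<close>

lemma orthogonal_tensorI: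
  assumes X: "norm_multiplicative ms m X" and max: "\<forall>x\<in>set ms. x \<le> m"
  shows "orthogonal_tensor (ms @ [m]) X"
proof (cases "sorted (ms @ [m])")
  case True
  with X show ?thesis by (simp add: orthogonal_tensor_def sorted_orthogonal_iff_norm_multiplicative)
next
  case False
  obtain p where p: "p permutes {..<length ms}" and sort: "permute_list p ms = sort ms"
    by (rule mset_eq_permutation[of "sort ms" ms]) auto
  have "p permutes {..<length (ms @ [m])}"
    by (rule permutes_subset[OF p]) auto
  moreover have "permute_list p (ms @ [m]) = sort ms @ [m]"
    by (simp add: permute_list_snoc[OF p] sort)
  moreover have "sorted (sort ms @ [m])"
    using max by (simp add: sorted_append)
  moreover have "sorted_orthogonal (sort ms @ [m]) (permute_modes p X)"
    using norm_multiplicative_permute_modes[OF p X]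
    by (simp add: sorted_orthogonal_iff_norm_multiplicative sort)
  ultimately show ?thesis using False by (auto simp: orthogonal_tensor_def)
qed

section \<open>Complex, quaternion and octonion products\<close>

text \<open>The product of two numbers with coordinates \<open>v\<close> and \<open>w\<close>. The coordinates of the factors are
  counted from 0, like rows and columns of the table, and those of the product from 1, like the
  entries of the table.\<close>

definition table_product :: "nat \<Rightarrow> (nat \<Rightarrow> real) \<Rightarrow> (nat \<Rightarrow> real) \<Rightarrow> nat \<Rightarrow> real" where
  "table_product n v w k =
     (\<Sum>i<n. \<Sum>j<n. if nat \<bar>mult_table n ! i ! j\<bar> = k
                    then v i * w j * sgn (real_of_int (mult_table n ! i ! j)) else 0)"

lemma all_less_numeral: "(\<forall>i<numeral k. P i) \<longleftrightarrow> P (pred_numeral k) \<and> (\<forall>i<pred_numeral k. P i)" for P :: "nat \<Rightarrow> bool"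
  by (simp add: numeral_eq_Suc All_less_Suc)

lemma mult_table_range:
  assumes "n \<in> {2, 4, 8}" "i < n" "j < n"
  shows "nat \<bar>mult_table n ! i ! j\<bar> \<in> {1..n}"
proof -
  have "\<forall>i<n. \<forall>j<n. nat \<bar>mult_table n ! i ! j\<bar> \<in> {1..n}"
    using assms(1) by (elim insertE emptyE) (simp_all add: mult_table_def all_less_numeral)
  with assms show ?thesis by blast
qed

text \<open>These are the two-square identity and the identities of Euler (four squares) and Degen (eight
  squares). Each is a polynomial identity in the coordinates, so it is proved by expanding both
  sides.\<close>

lemma table_product_norm:
  assumes "n \<in> {2, 4, 8}"
  shows "(\<Sum>k\<in>{1..n}. (table_product n v w k)\<^sup>2) = (\<Sum>i<n. (v i)\<^sup>2) * (\<Sum>j<n. (w j)\<^sup>2)"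
proof -
  have ranges: "{Suc 0..2} = {1, 2 :: nat}" "{Suc 0..4} = {1, 2, 3, 4 :: nat}"
      "{Suc 0..8} = {1, 2, 3, 4, 5, 6, 7, 8 :: nat}"
      "{..<2} = {0, 1 :: nat}" "{..<4} = {0, 1, 2, 3 :: nat}"
      "{..<8} = {0, 1, 2, 3, 4, 5, 6, 7 :: nat}"
    by auto
  from assms consider "n = 2" | "n = 4" | "n = 8" by auto
  then show ?thesis
  proof cases
    case 1
    show ?thesis unfolding 1
      by (simp add: ranges table_product_def mult_table_def) algebra
  next
    case 2
    show ?thesis unfolding 2
      by (simp add: ranges table_product_def mult_table_def) algebra
  next
    case 3
    show ?thesis unfolding 3
      by (simp add: ranges table_product_def mult_table_def) algebra
  qed
qed

lemma L2_set_table_product: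
  assumes "n \<in> {2, 4, 8}"
  shows "L2_set (table_product n v w) {1..n} = L2_set v {..<n} * L2_set w {..<n}"
  using table_product_norm[OF assms] by (simp add: L2_set_def real_sqrt_mult)

section \<open>Replacing the table entries by slices\<close>

text \<open>The image of \<open>x\<close> under the embedding that sends the \<open>k\<close>-th unit vector to the \<open>s k\<close>-th one. It
  is an isometry when \<open>s\<close> is injective on \<open>A\<close>.\<close>

definition scatter :: "(nat \<Rightarrow> nat) \<Rightarrow> nat set \<Rightarrow> (nat \<Rightarrow> real) \<Rightarrow> nat \<Rightarrow> real" where
  "scatter s A x i = (if i \<in> s ` A then x (inv_into A s i) else 0)"

lemma sum_scatter:
  fixes f :: "nat \<Rightarrow> real \<Rightarrow> real"
  assumes "inj_on s A" "\<forall>k\<in>A. s k < N" "\<And>i. f i 0 = 0"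
  shows "(\<Sum>i<N. f i (scatter s A x i)) = (\<Sum>k\<in>A. f (s k) (x k))"
proof -
  have "(\<Sum>i<N. f i (scatter s A x i)) = (\<Sum>i\<in>s ` A. f i (scatter s A x i))"
    using assms by (intro sum.mono_neutral_right) (auto simp: scatter_def)
  also have "\<dots> = (\<Sum>k\<in>A. f (s k) (x k))"
    using assms(1) by (simp add: sum.reindex scatter_def)
  finally show ?thesis .
qed

lemma L2_set_scatter:
  assumes "inj_on s A" "\<forall>k\<in>A. s k < N"
  shows "L2_set (scatter s A x) {..<N} = L2_set x A"
  unfolding L2_set_def by (simp add: sum_scatter[OF assms, where f = "\<lambda>_ y. y\<^sup>2"])

text \<open>Collecting the table entries by their absolute value.\<close>

lemma sum_over_table:
  assumes "n \<in> {2, 4, 8}"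
  shows "(\<Sum>j<n. w j * (\<Sum>i<n. v i * (sgn (real_of_int (mult_table n ! i ! j)) *
             G (nat \<bar>mult_table n ! i ! j\<bar>)))) = (\<Sum>k\<in>{1..n}. table_product n v w k * G k)"
    (is "?lhs = ?rhs")
proof -
  have "?rhs = (\<Sum>i<n. \<Sum>j<n. \<Sum>k\<in>{1..n}. if nat \<bar>mult_table n ! i ! j\<bar> = k
      then v i * w j * sgn (real_of_int (mult_table n ! i ! j)) * G k else 0)"
  proof -
    have "?rhs = (\<Sum>k\<in>{1..n}. \<Sum>i<n. \<Sum>j<n. if nat \<bar>mult_table n ! i ! j\<bar> = k
        then v i * w j * sgn (real_of_int (mult_table n ! i ! j)) * G k else 0)"
      by (auto simp: table_product_def sum_distrib_right intro!: sum.cong)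
    also have "\<dots> = (\<Sum>i<n. \<Sum>k\<in>{1..n}. \<Sum>j<n. if nat \<bar>mult_table n ! i ! j\<bar> = k
        then v i * w j * sgn (real_of_int (mult_table n ! i ! j)) * G k else 0)"
      by (rule sum.swap)
    finally show ?thesis by (simp only: sum.swap[of _ "{..<n}" "{1..n}"])
  qed
  also have "\<dots> = (\<Sum>i<n. \<Sum>j<n. v i * w j * sgn (real_of_int (mult_table n ! i ! j)) *
      G (nat \<bar>mult_table n ! i ! j\<bar>))"
    using mult_table_range[OF assms] by (intro sum.cong refl) (simp only: sum.delta' sum.delta finite_atLeastAtMost lessThan_iff if_True)
  also have "\<dots> = ?lhs"
    by (subst sum.swap) (simp add: sum_distrib_left mult_ac)
  finally show ?thesis ..
qed

text \<open>Vectors for the modes of \<open>X\<close> made from vectors for the modes of \<open>Y\<close>: those of the table modes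
  \<open>\<mu>\<close> and \<open>\<mu> + 1\<close> are multiplied, and the product is placed at the indices of the chosen slices.\<close>

definition merge_table_modes ::
  "nat \<Rightarrow> (nat \<Rightarrow> nat) \<Rightarrow> nat \<Rightarrow> (nat \<Rightarrow> nat \<Rightarrow> real) \<Rightarrow> nat \<Rightarrow> nat \<Rightarrow> real" where
  "merge_table_modes n s \<mu> U k =
     (if k < \<mu> then U k
      else if k = \<mu> then scatter s {1..n} (table_product n (U \<mu>) (U (Suc \<mu>)))
      else U (Suc k))"

text \<open>The hypothesis on \<open>Y\<close> says that the entry \<open>\<plusminus> k\<close> of the table was replaced by the slice \<open>\<plusminus> X\<^sub>k\<close>.
  Contraction is linear, so contracting the table modes of \<open>Y\<close> first leaves a combination of
  these slices, whose coefficients form the table product of the two vectors.\<close>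

lemma contract_table_tensor:
  assumes n: "n \<in> {2, 4, 8}"
    and s: "inj_on s {1..n}" "\<forall>k\<in>{1..n}. s k < N"
    and Y: "\<And>i j is. i < n \<Longrightarrow> j < n \<Longrightarrow> valid_index (as @ bs) is \<Longrightarrow>
      slice (length as) i (slice (Suc (length as)) j Y) is =
      sgn (real_of_int (mult_table n ! i ! j)) *
        slice (length as) (s (nat \<bar>mult_table n ! i ! j\<bar>)) X is"
  shows "contract (as @ n # n # bs) Y U =
    contract (as @ N # bs) X (merge_table_modes n s (length as) U)"
proof -
  define \<mu> where "\<mu> = length as"
  define V where "V = (\<lambda>k. U (if k < \<mu> then k else Suc (Suc k)))"
  define G where "G = (\<lambda>i. contract (as @ bs) (slice \<mu> i X) V)"
  let ?T = "\<lambda>i j. mult_table n ! i ! j"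
  \<comment> \<open>Mode \<open>\<mu> + 1\<close> is expanded before mode \<open>\<mu>\<close>, so that the position of the latter does not move.\<close>
  have "contract (as @ n # n # bs) Y U =
      (\<Sum>j<n. U (Suc \<mu>) j * (\<Sum>i<n. U \<mu> i *
        contract (as @ bs) (slice \<mu> i (slice (Suc \<mu>) j Y)) V))"
  proof -
    define U' where "U' = (\<lambda>k. U (if k < Suc \<mu> then k else Suc k))"
    have "U' \<mu> = U \<mu>" "(\<lambda>k. U' (if k < \<mu> then k else Suc k)) = V"
      by (auto simp: U'_def V_def)
    then have "contract (as @ n # bs) Z U' =
        (\<Sum>i<n. U \<mu> i * contract (as @ bs) (slice \<mu> i Z) V)" for Z
      using contract_insert_mode[of \<mu> "as @ bs" n Z U'] by (simp add: \<mu>_def)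
    then show ?thesis
      using contract_insert_mode[of "Suc \<mu>" "as @ n # bs" n Y U] by (simp add: \<mu>_def U'_def)
  qed
  also have "\<dots> = (\<Sum>j<n. U (Suc \<mu>) j * (\<Sum>i<n. U \<mu> i *
      (sgn (real_of_int (?T i j)) * G (s (nat \<bar>?T i j\<bar>)))))"
  proof (intro sum.cong refl arg_cong2[where f = "(*)"])
    fix i j assume "j \<in> {..<n}" "i \<in> {..<n}"
    then show "contract (as @ bs) (slice \<mu> i (slice (Suc \<mu>) j Y)) V =
        sgn (real_of_int (?T i j)) * G (s (nat \<bar>?T i j\<bar>))"
      unfolding G_def contract_cmult[symmetric]
      by (intro contract_cong) (simp add: Y \<mu>_def)
  qed
  also have "\<dots> = (\<Sum>k\<in>{1..n}. table_product n (U \<mu>) (U (Suc \<mu>)) k * G (s k))"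
    by (rule sum_over_table[OF n])
  also have "\<dots> = (\<Sum>i<N. scatter s {1..n} (table_product n (U \<mu>) (U (Suc \<mu>))) i * G i)"
    by (subst sum_scatter[OF s, where f = "\<lambda>i y. y * G i"]) simp_all
  also have "\<dots> = contract (as @ N # bs) X (merge_table_modes n s \<mu> U)"
  proof -
    have "(\<lambda>k. merge_table_modes n s \<mu> U (if k < \<mu> then k else Suc k)) = V"
      by (auto simp: merge_table_modes_def V_def)
    moreover have "merge_table_modes n s \<mu> U \<mu> =
        scatter s {1..n} (table_product n (U \<mu>) (U (Suc \<mu>)))"
      by (simp add: merge_table_modes_def)
    ultimately show ?thesis
      using contract_insert_mode[of \<mu> "as @ bs" N X "merge_table_modes n s \<mu> U"]
      by (simp add: \<mu>_def G_def)
  qed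
  finally show ?thesis by (simp add: \<mu>_def)
qed

lemma prod_nth_append:
  "(\<Prod>k<length (xs @ ys). f k ((xs @ ys) ! k)) =
   (\<Prod>k<length xs. f k (xs ! k)) * (\<Prod>k<length ys. f (length xs + k) (ys ! k))"
  for f :: "nat \<Rightarrow> 'a \<Rightarrow> 'b :: comm_monoid_mult"
proof (induction xs arbitrary: f)
  case (Cons x xs)
  show ?case
    using Cons.IH[of "\<lambda>k. f (Suc k)"]
    by (simp add: prod.lessThan_Suc_shift mult.assoc del: prod.lessThan_Suc)
qed simp

lemma valid_index_snoc:
  "valid_index ms is \<Longrightarrow> l < m \<Longrightarrow> valid_index (ms @ [m]) (is @ [l])"
  by (auto simp: valid_index_def nth_append less_Suc_eq)

text \<open>Merging the vectors of the table modes preserves the product of the norms: the table product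
  is multiplicative for norms and \<open>scatter\<close> is an isometry.\<close>

lemma norm_multiplicative_table_tensor:
  assumes n: "n \<in> {2, 4, 8}"
    and s: "inj_on s {1..n}" "\<forall>k\<in>{1..n}. s k < N"
    and X: "norm_multiplicative (as @ N # bs) m X"
    and Y: "\<And>i j is. i < n \<Longrightarrow> j < n \<Longrightarrow> valid_index (as @ bs @ [m]) is \<Longrightarrow>
      slice (length as) i (slice (Suc (length as)) j Y) is =
      sgn (real_of_int (mult_table n ! i ! j)) *
        slice (length as) (s (nat \<bar>mult_table n ! i ! j\<bar>)) X is"
  shows "norm_multiplicative (as @ n # n # bs) m Y"
  unfolding norm_multiplicative_def
proof
  fix U :: "nat \<Rightarrow> nat \<Rightarrow> real"
  define V where "V = merge_table_modes n s (length as) U"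
  have "contract (as @ n # n # bs) (\<lambda>is. Y (is @ [l])) U =
      contract (as @ N # bs) (\<lambda>is. X (is @ [l])) V" if "l < m" for l
    unfolding V_def
  proof (rule contract_table_tensor[OF n s])
    fix i j "is" assume ij: "i < n" "j < n" and "is": "valid_index (as @ bs) is"
    then have "length is = length as + length bs" by (simp add: valid_index_def)
    moreover have "valid_index (as @ bs @ [m]) (is @ [l])"
      using valid_index_snoc[OF "is" \<open>l < m\<close>] by simp
    ultimately show "slice (length as) i (slice (Suc (length as)) j (\<lambda>is. Y (is @ [l]))) is =
        sgn (real_of_int (mult_table n ! i ! j)) *
          slice (length as) (s (nat \<bar>mult_table n ! i ! j\<bar>)) (\<lambda>is. X (is @ [l])) is"
      using Y[OF ij, of "is @ [l]"] by (simp add: slice_def)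
  qed
  then have "L2_set (\<lambda>l. contract (as @ n # n # bs) (\<lambda>is. Y (is @ [l])) U) {..<m} =
      L2_set (\<lambda>l. contract (as @ N # bs) (\<lambda>is. X (is @ [l])) V) {..<m}"
    by (intro L2_set_cong) auto
  also have "\<dots> = (\<Prod>k<length (as @ N # bs). L2_set (V k) {..<(as @ N # bs) ! k})"
    using X by (simp add: norm_multiplicative_def)
  also have "\<dots> = (\<Prod>k<length as. L2_set (U k) {..<as ! k}) *
      (L2_set (U (length as)) {..<n} * L2_set (U (Suc (length as))) {..<n} *
       (\<Prod>k<length bs. L2_set (U (Suc (Suc (length as + k)))) {..<bs ! k}))"
    unfolding prod_nth_append[where f = "\<lambda>k d. L2_set (V k) {..<d}"]
    by (simp add: prod.lessThan_Suc_shift V_def merge_table_modes_def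
        L2_set_scatter[OF s] L2_set_table_product[OF n] del: prod.lessThan_Suc One_nat_def)
  also have "\<dots> = (\<Prod>k<length (as @ n # n # bs). L2_set (U k) {..<(as @ n # n # bs) ! k})"
    unfolding prod_nth_append[where f = "\<lambda>k d. L2_set (U k) {..<d}"]
    by (simp add: prod.lessThan_Suc_shift mult.assoc del: prod.lessThan_Suc)
  finally show "L2_set (\<lambda>l. contract (as @ n # n # bs) (\<lambda>is. Y (is @ [l])) U) {..<m} =
      (\<Prod>k<length (as @ n # n # bs). L2_set (U k) {..<(as @ n # n # bs) ! k})" .
qed

theorem theorem4p5:
  fixes n \<mu> :: nat and ns :: "nat list" and X Y :: tensor and s :: "nat \<Rightarrow> nat"
  assumes order: "2 \<le> length ns"
    and n: "n \<in> {2, 4, 8}"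
    and pos: "\<forall>m \<in> set ns. 0 < m"
    and sorted: "sorted ns"
    and X: "orthogonal_tensor ns X"
    and mode: "\<mu> < length ns - 1" "n \<le> ns ! \<mu>"
    and slices: "inj_on s {1..n}" "\<forall>k \<in> {1..n}. s k < ns ! \<mu>"
    and Y_pos: "\<And>i j k. i < n \<Longrightarrow> j < n \<Longrightarrow> k \<in> {1..n} \<Longrightarrow> mult_table n ! i ! j = int k \<Longrightarrow>
      tensor_eq (take \<mu> ns @ drop (Suc \<mu>) ns)
        (slice \<mu> i (slice (Suc \<mu>) j Y)) (slice \<mu> (s k) X)"
    and Y_neg: "\<And>i j k. i < n \<Longrightarrow> j < n \<Longrightarrow> k \<in> {1..n} \<Longrightarrow> mult_table n ! i ! j = - int k \<Longrightarrow>
      tensor_eq (take \<mu> ns @ drop (Suc \<mu>) ns)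
        (slice \<mu> i (slice (Suc \<mu>) j Y)) (\<lambda>is. - slice \<mu> (s k) X is)"
  shows "orthogonal_tensor (take \<mu> ns @ [n, n] @ drop (Suc \<mu>) ns) Y"
proof -
  define as where "as = take \<mu> ns"
  define bs where "bs = drop (Suc \<mu>) (butlast ns)"
  define m where "m = last ns"
  define N where "N = ns ! \<mu>"
  have "ns \<noteq> []" using order by auto
  have as: "length as = \<mu>" using mode by (simp add: as_def)
  have rest: "drop (Suc \<mu>) ns = bs @ [m]"
    using mode \<open>ns \<noteq> []\<close> append_butlast_last_id[of ns]
    by (metis bs_def m_def drop_append drop_0 length_butlast Suc_leI diff_is_0_eq')
  have ns: "ns = (as @ N # bs) @ [m]"
    using mode id_take_nth_drop[of \<mu> ns] by (simp add: as_def N_def rest)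
  have max: "\<forall>x\<in>set (as @ n # n # bs). x \<le> m"
  proof -
    have "\<forall>x\<in>set (as @ N # bs). x \<le> m" using sorted by (auto simp: ns sorted_append)
    then show ?thesis using mode(2) by (auto simp: N_def[symmetric])
  qed
  have X': "norm_multiplicative (as @ N # bs) m X"
    using X sorted by (simp add: ns orthogonal_tensor_def flip: sorted_orthogonal_iff_norm_multiplicative)
  have "norm_multiplicative (as @ n # n # bs) m Y"
  proof (rule norm_multiplicative_table_tensor[OF n slices(1) _ X'])
    show "\<forall>k\<in>{1..n}. s k < N" using slices(2) by (simp add: N_def)
  next
    fix i j "is" assume ij: "i < n" "j < n" and "is": "valid_index (as @ bs @ [m]) is"
    let ?t = "mult_table n ! i ! j"
    have k: "nat \<bar>?t\<bar> \<in> {1..n}" by (rule mult_table_range[OF n ij])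
    show "slice (length as) i (slice (Suc (length as)) j Y) is =
        sgn (real_of_int ?t) * slice (length as) (s (nat \<bar>?t\<bar>)) X is"
    proof (cases "?t > 0")
      case True
      with Y_pos[OF ij k] "is" show ?thesis
        by (simp add: tensor_eq_def as as_def[symmetric] rest)
    next
      case False
      with k have "?t < 0" by auto
      with Y_neg[OF ij k] "is" show ?thesis
        by (simp add: tensor_eq_def as as_def[symmetric] rest)
    qed
  qed
  then show ?thesis
    using orthogonal_tensorI[OF _ max] by (simp add: as_def[symmetric] rest)
qed

end
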